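(* Let $p\in[0,1]$, let $a,s,b$ be distinct vertices, let $A:=\{a\not\to s\}$ and $B:=\{s\not\to b\}$, and let $N:=\binom n2$. Let $M\sim\operatorname{Bin}(N,p)$ be the number of edges of $G(n,p)$. Then \[ \operatorname{Cov}_{\vec G(n,p)}(A,B)=\mathbb E\bigl(\operatorname{Cov}(A,B\mid M)\bigr)+\operatorname{Var}\bigl(\mathbb P(A\mid M)\bigr), \] where \[ \mathbb E\bigl(\operatorname{Cov}(A,B\mid M)\bigr)=\sum_{m=0}^{N}\mathbb P(M=m)\cdot\operatorname{Cov}_{\vec G(n,m)}(A,B). \]
   Context: $G(n,p)$ is the random graph on $n$ labelled vertices in which each possible edge is present independently with probability $p$; $G(n,m)$ is the random graph with $n$ labelled vertices and $m$ edges, uniformly chosen among all such graphs (so $G(n,m)$ is $G(n,p)$ conditioned on $M=m$). $\vec G(n,p)$ and $\vec G(n,m)$ are obtained by giving each edge one of its two orientations with probability $1/2$ each, independently of everything else; probabilities are in the combined space of graph and orientations. $\{u\not\to v\}$ is the event that there is no directed path from $u$ to $v$. For events $A,B$, $\operatorname{Cov}(A,B):=\mathbb P(A\cap B)-\mathbb P(A)\mathbb P(B)$ (in the space indicated by the subscript), and $\operatorname{Cov}(A,B\mid M):=\mathbb P(A\cap B\mid M)-\mathbb P(A\mid M)\mathbb P(B\mid M)$ in $\vec G(n,p)$. *)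

theory Defs
  imports "HOL-Probability.Probability" "HOL-Library.Ramsey"
begin

text \<open>
  The vertex set is \<open>{..<n}\<close>; a graph is identified with its edge set, a subset of
  \<open>nsets {..<n} 2\<close>, the set of two-element subsets of \<open>{..<n}\<close>.
\<close>

definition gnp :: "nat \<Rightarrow> real \<Rightarrow> nat set set pmf" where
  "gnp n p = map_pmf (\<lambda>f. {e \<in> nsets {..<n} 2. f e})
               (Pi_pmf (nsets {..<n} 2) False (\<lambda>_. bernoulli_pmf p))"

text \<open>Meaningful only for \<open>m \<le> n choose 2\<close>; otherwise the set of graphs is empty.\<close>

definition gnm :: "nat \<Rightarrow> nat \<Rightarrow> nat set set pmf" where
  "gnm n m = pmf_of_set {G. G \<subseteq> nsets {..<n} 2 \<and> card G = m}"

text \<open>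
  A point of the combined space is a graph together with a map sending each of its edges
  \<open>{u, v}\<close> to one of \<open>(u, v)\<close> and \<open>(v, u)\<close>. Off the edge set the map takes the dummy
  value \<open>(0, 0)\<close>.
\<close>

type_synonym oriented_graph = "nat set set \<times> (nat set \<Rightarrow> nat \<times> nat)"

definition orient :: "nat set set \<Rightarrow> oriented_graph pmf" where
  "orient G = map_pmf (\<lambda>d. (G, d)) (Pi_pmf G (0, 0) (\<lambda>e. pmf_of_set {(u, v). e = {u, v}}))"

definition oriented_gnp :: "nat \<Rightarrow> real \<Rightarrow> oriented_graph pmf" where
  "oriented_gnp n p = bind_pmf (gnp n p) orient"

definition oriented_gnm :: "nat \<Rightarrow> nat \<Rightarrow> oriented_graph pmf" where
  "oriented_gnm n m = bind_pmf (gnm n m) orient"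

definition num_edges :: "oriented_graph \<Rightarrow> nat" where
  "num_edges \<omega> = card (fst \<omega>)"

definition arcs :: "oriented_graph \<Rightarrow> (nat \<times> nat) set" where
  "arcs \<omega> = snd \<omega> ` fst \<omega>"

definition no_path :: "nat \<Rightarrow> nat \<Rightarrow> oriented_graph set" where
  "no_path u v = {\<omega>. (u, v) \<notin> (arcs \<omega>)\<^sup>*}"

definition event_cov :: "'a pmf \<Rightarrow> 'a set \<Rightarrow> 'a set \<Rightarrow> real" where
  "event_cov P A B =
     measure_pmf.prob P (A \<inter> B) - measure_pmf.prob P A * measure_pmf.prob P B"

text \<open>
  Conditioning on a discrete random variable \<open>X\<close>: the random variable whose value at
  \<open>\<omega>\<close> is the elementary conditional probability of \<open>A\<close> given that \<open>X\<close> takes the value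
  \<open>X \<omega>\<close>.
\<close>

definition prob_given :: "'a pmf \<Rightarrow> 'a set \<Rightarrow> ('a \<Rightarrow> 'b) \<Rightarrow> 'a \<Rightarrow> real" where
  "prob_given P A X \<omega> = cond_prob (measure_pmf P) (\<lambda>\<eta>. \<eta> \<in> A) (\<lambda>\<eta>. X \<eta> = X \<omega>)"

definition event_cov_given ::
  "'a pmf \<Rightarrow> 'a set \<Rightarrow> 'a set \<Rightarrow> ('a \<Rightarrow> 'b) \<Rightarrow> 'a \<Rightarrow> real" where
  "event_cov_given P A B X \<omega> =
     prob_given P (A \<inter> B) X \<omega> - prob_given P A X \<omega> * prob_given P B X \<omega>"

end

theory Submission
  imports Defs
begin

text \<open>
  The edge count \<open>M\<close> exhibits the oriented random graph with edge probability \<open>p\<close> as a mixture: draw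
  \<open>m\<close> from the binomial distribution, then draw an oriented graph with exactly \<open>m\<close> edges
  (\<open>oriented_gnp_mixture\<close>).  The underlying reason is that all graphs with \<open>m\<close> edges have the same
  probability \<open>p ^ m * (1 - p) ^ (N - m)\<close>.  In a mixture whose index is recovered from the outcome,
  conditioning on the index selects the corresponding component, so conditional probabilities given
  \<open>M\<close> are probabilities in the model with \<open>m\<close> edges (\<open>prob_given_mixture\<close>).

  The law of total covariance (\<open>event_cov_mixture\<close>) then splits the covariance of \<open>A\<close> and \<open>B\<close> into
  the expected conditional covariance and the covariance of the two conditional probabilities.  The
  second part is a variance as soon as these two conditional probabilities agree, and they do by
  symmetry: a relabelling of the vertices that sends \<open>a\<close> to \<open>s\<close> and \<open>s\<close> to \<open>b\<close> preserves the model
  with \<open>m\<close> edges and turns \<open>A\<close> into \<open>B\<close> (\<open>prob_no_path_permute\<close>).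
\<close>

section \<open>Mixtures whose index is determined by the outcome\<close>

lemma integrable_prob_pmf:
  "integrable (measure_pmf Q) (\<lambda>m. measure_pmf.prob (K m) A)"
  by (rule measure_pmf.integrable_const_bound[where B = 1]) auto

lemma integrable_prob_mult_pmf:
  "integrable (measure_pmf Q) (\<lambda>m. measure_pmf.prob (K m) A * measure_pmf.prob (K m) B)"
  by (rule measure_pmf.integrable_const_bound[where B = 1]) (auto intro!: mult_le_one)

lemma prob_bind_pmf:
  "measure_pmf.prob (bind_pmf Q K) A = measure_pmf.expectation Q (\<lambda>m. measure_pmf.prob (K m) A)"
proof -
  have prob_True: "measure_pmf.prob R A = pmf (map_pmf (\<lambda>x. x \<in> A) R) True" for R
    by (auto simp: pmf_map intro!: arg_cong[where f = "measure_pmf.prob R"])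
  show ?thesis
    unfolding prob_True map_bind_pmf pmf_bind ..
qed

lemma map_pmf_mixture:
  assumes index: "\<And>m x. m \<in> set_pmf Q \<Longrightarrow> x \<in> set_pmf (K m) \<Longrightarrow> X x = m"
  shows "map_pmf X (bind_pmf Q K) = Q"
proof -
  have "map_pmf X (K m) = return_pmf m" if "m \<in> set_pmf Q" for m
  proof -
    have "map_pmf X (K m) = map_pmf (\<lambda>_. m) (K m)"
      using index that by (intro map_pmf_cong) auto
    then show ?thesis by simp
  qed
  then have "map_pmf X (bind_pmf Q K) = bind_pmf Q return_pmf"
    unfolding map_bind_pmf by (intro bind_pmf_cong) auto
  then show ?thesis by (simp add: bind_return_pmf')
qed

text \<open>
  Only the component with index \<open>m\<close> charges the event that \<open>X\<close> equals \<open>m\<close>, and it lives entirely on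
  that event.
\<close>

lemma prob_mixture_fibre:
  assumes index: "\<And>m x. m \<in> set_pmf Q \<Longrightarrow> x \<in> set_pmf (K m) \<Longrightarrow> X x = m"
    and m: "m \<in> set_pmf Q"
  shows "measure_pmf.prob (bind_pmf Q K) {x. x \<in> A \<and> X x = m}
    = pmf Q m * measure_pmf.prob (K m) A"
proof -
  have other: "measure_pmf.prob (K k) {x. x \<in> A \<and> X x = m} = 0" if "k \<in> set_pmf Q" "k \<noteq> m" for k
    using index[OF that(1)] that(2) by (auto simp: measure_pmf_zero_iff)
  have "measure_pmf.prob (K m) {x. x \<in> A \<and> X x = m} = measure_pmf.prob (K m) A"
    using index[OF m] by (intro measure_pmf.finite_measure_eq_AE) (auto simp: AE_measure_pmf_iff)
  moreover have "measure_pmf.expectation Q (\<lambda>k. measure_pmf.prob (K k) {x. x \<in> A \<and> X x = m})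
      = (\<Sum>k\<in>{m}. pmf Q k *\<^sub>R measure_pmf.prob (K k) {x. x \<in> A \<and> X x = m})"
    using other by (intro integral_measure_pmf) auto
  ultimately show ?thesis
    by (simp add: prob_bind_pmf)
qed

text \<open>
  The weight of the component cancels in the quotient defining the conditional probability.  Outside
  the support of the mixture that quotient may be \<open>0 / 0\<close>, whence the restriction on \<open>\<omega>\<close>.
\<close>

lemma prob_given_mixture:
  assumes index: "\<And>m x. m \<in> set_pmf Q \<Longrightarrow> x \<in> set_pmf (K m) \<Longrightarrow> X x = m"
    and \<omega>: "\<omega> \<in> set_pmf (bind_pmf Q K)"
  shows "prob_given (bind_pmf Q K) A X \<omega> = measure_pmf.prob (K (X \<omega>)) A"
proof -
  have X: "X \<omega> \<in> set_pmf Q"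
    using \<omega> index by auto
  then have pos: "pmf Q (X \<omega>) \<noteq> 0"
    by (simp add: set_pmf_iff)
  show ?thesis
    using prob_mixture_fibre[of Q K X "X \<omega>" A] prob_mixture_fibre[of Q K X "X \<omega>" UNIV] index X pos
    by (simp add: prob_given_def cond_prob_def)
qed

lemma expectation_mixture_index:
  fixes h :: "'b \<Rightarrow> real"
  assumes index: "\<And>m x. m \<in> set_pmf Q \<Longrightarrow> x \<in> set_pmf (K m) \<Longrightarrow> X x = m"
    and g: "\<And>\<omega>. \<omega> \<in> set_pmf (bind_pmf Q K) \<Longrightarrow> g \<omega> = h (X \<omega>)"
  shows "measure_pmf.expectation (bind_pmf Q K) g = measure_pmf.expectation Q h"
proof -
  have "measure_pmf.expectation (bind_pmf Q K) g
      = measure_pmf.expectation (bind_pmf Q K) (\<lambda>\<omega>. h (X \<omega>))"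
    using g by (intro integral_cong_AE) (auto simp: AE_measure_pmf_iff)
  also have "\<dots> = measure_pmf.expectation (map_pmf X (bind_pmf Q K)) h"
    by simp
  also have "\<dots> = measure_pmf.expectation Q h"
    using index by (subst map_pmf_mixture) auto
  finally show ?thesis .
qed

lemma expectation_event_cov_given_mixture:
  assumes index: "\<And>m x. m \<in> set_pmf Q \<Longrightarrow> x \<in> set_pmf (K m) \<Longrightarrow> X x = m"
  shows "measure_pmf.expectation (bind_pmf Q K) (event_cov_given (bind_pmf Q K) A B X)
    = measure_pmf.expectation Q (\<lambda>m. event_cov (K m) A B)"
proof (rule expectation_mixture_index[OF index])
  fix \<omega> assume "\<omega> \<in> set_pmf (bind_pmf Q K)"
  then show "event_cov_given (bind_pmf Q K) A B X \<omega> = event_cov (K (X \<omega>)) A B"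
    unfolding event_cov_given_def event_cov_def
    using prob_given_mixture[of Q K X \<omega>] index by simp
qed auto

text \<open>
  The law of total covariance, in the case where \<open>A\<close> and \<open>B\<close> have the same conditional
  probabilities, so that the covariance of these is the variance of either.
\<close>

lemma event_cov_mixture:
  assumes index: "\<And>m x. m \<in> set_pmf Q \<Longrightarrow> x \<in> set_pmf (K m) \<Longrightarrow> X x = m"
    and same: "\<And>m. m \<in> set_pmf Q \<Longrightarrow> measure_pmf.prob (K m) A = measure_pmf.prob (K m) B"
  defines "P \<equiv> bind_pmf Q K"
  shows "event_cov P A B = measure_pmf.expectation P (event_cov_given P A B X)
    + measure_pmf.variance P (prob_given P A X)"
proof -
  define f where "f m = measure_pmf.prob (K m) A" for m
  define f' where "f' m = measure_pmf.prob (K m) B" for m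
  define h where "h m = measure_pmf.prob (K m) (A \<inter> B)" for m
  have integrable: "integrable (measure_pmf Q) f" "integrable (measure_pmf Q) h"
      "integrable (measure_pmf Q) (\<lambda>m. f m * f' m)" "integrable (measure_pmf Q) (\<lambda>m. (f m)\<^sup>2)"
    unfolding f_def f'_def h_def power2_eq_square
    by (rule integrable_prob_pmf integrable_prob_mult_pmf)+
  have cov: "event_cov P A B = measure_pmf.expectation Q h
      - measure_pmf.expectation Q f * measure_pmf.expectation Q f'"
    unfolding event_cov_def P_def prob_bind_pmf f_def f'_def h_def ..
  have f': "measure_pmf.expectation Q f' = measure_pmf.expectation Q f"
    "measure_pmf.expectation Q (\<lambda>m. f m * f' m) = measure_pmf.expectation Q (\<lambda>m. (f m)\<^sup>2)"
    using same by (auto intro!: integral_cong_AE simp: AE_measure_pmf_iff f_def f'_def power2_eq_square)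
  have "measure_pmf.expectation P (event_cov_given P A B X)
      = measure_pmf.expectation Q (\<lambda>m. h m - f m * f' m)"
    unfolding P_def f_def f'_def h_def event_cov_def[symmetric]
    by (rule expectation_event_cov_given_mixture) (rule index)
  also have "\<dots> = measure_pmf.expectation Q h - measure_pmf.expectation Q (\<lambda>m. (f m)\<^sup>2)"
    using integrable f' by simp
  finally have given: "measure_pmf.expectation P (event_cov_given P A B X)
      = measure_pmf.expectation Q h - measure_pmf.expectation Q (\<lambda>m. (f m)\<^sup>2)" .
  have prob: "prob_given P A X \<omega> = f (X \<omega>)" if "\<omega> \<in> set_pmf P" for \<omega>
    using prob_given_mixture[of Q K X \<omega>] index that by (simp add: P_def f_def)
  have mean: "measure_pmf.expectation P (prob_given P A X) = measure_pmf.expectation Q f"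
    using prob unfolding P_def by (intro expectation_mixture_index[OF index]) auto
  have "measure_pmf.variance P (prob_given P A X) = measure_pmf.variance Q f"
    unfolding mean using prob unfolding P_def
    by (intro expectation_mixture_index[OF index]) auto
  also have "\<dots> = measure_pmf.expectation Q (\<lambda>m. (f m)\<^sup>2) - (measure_pmf.expectation Q f)\<^sup>2"
    using integrable by (intro measure_pmf.variance_eq) auto
  finally show ?thesis
    using cov given f' by (simp add: power2_eq_square)
qed

section \<open>Decomposition of the binomial random graph by its number of edges\<close>

abbreviation (input) graphs :: "nat \<Rightarrow> nat \<Rightarrow> nat set set set" where
  "graphs n m \<equiv> {G. G \<subseteq> nsets {..<n} 2 \<and> card G = m}"

lemma finite_edges [simp]: "finite (nsets {..<n::nat} k)"
  by (simp add: finite_imp_finite_nsets)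

lemma card_edges: "card (nsets {..<n::nat} 2) = n choose 2"
  using binomial_eq_nsets[of n 2] by (simp add: atLeast0LessThan)

lemma finite_graphs: "finite (graphs n m)"
  by (rule finite_subset[of _ "Pow (nsets {..<n} 2)"]) auto

lemma card_graphs: "card (graphs n m) = (n choose 2) choose m"
  using n_subsets[of "nsets {..<n} 2" m] by (simp add: card_edges)

lemma graphs_nonempty:
  assumes "m \<le> n choose 2"
  shows "graphs n m \<noteq> {}"
proof -
  have "card (graphs n m) \<noteq> 0"
    using assms by (simp only: card_graphs binomial_eq_0_iff)
  then show ?thesis by fastforce
qed

lemma set_pmf_gnm:
  assumes "m \<le> n choose 2"
  shows "set_pmf (gnm n m) = graphs n m"
  unfolding gnm_def using assms by (intro set_pmf_of_set graphs_nonempty finite_graphs)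

lemma pmf_gnp:
  assumes p: "0 \<le> p" "p \<le> 1"
  shows "pmf (gnp n p) G =
    (if G \<subseteq> nsets {..<n} 2 then p ^ card G * (1 - p) ^ ((n choose 2) - card G) else 0)"
proof (cases "G \<subseteq> nsets {..<n} 2")
  case True
  define E where "E = nsets {..<n} 2"
  define R where "R = Pi_pmf E False (\<lambda>_. bernoulli_pmf p)"
  have [simp]: "finite E" and "G \<subseteq> E"
    using True by (auto simp: E_def)
  have "(\<lambda>f. {e \<in> E. f e}) -` {G} \<inter> set_pmf R = {\<lambda>e. e \<in> G} \<inter> set_pmf R"
  proof -
    have "f = (\<lambda>e. e \<in> {e \<in> E. f e})" if "f \<in> set_pmf R" for f
      using that set_Pi_pmf_subset[of E False "\<lambda>_. bernoulli_pmf p"] by (fastforce simp: R_def)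
    moreover have "{e \<in> E. e \<in> G} = G"
      using \<open>G \<subseteq> E\<close> by blast
    ultimately show ?thesis by (auto simp: fun_eq_iff)
  qed
  then have "measure_pmf.prob R ((\<lambda>f. {e \<in> E. f e}) -` {G}) = measure_pmf.prob R {\<lambda>e. e \<in> G}"
    by (subst (1 2) measure_Int_set_pmf[symmetric]) (rule arg_cong)
  then have "pmf (gnp n p) G = pmf R (\<lambda>e. e \<in> G)"
    by (simp add: gnp_def pmf_map measure_pmf_single E_def R_def)
  also have "\<dots> = (\<Prod>e\<in>E. pmf (bernoulli_pmf p) (e \<in> G))"
    unfolding R_def using \<open>G \<subseteq> E\<close> by (intro pmf_Pi') auto
  also have "\<dots> = (\<Prod>e\<in>E - G. pmf (bernoulli_pmf p) (e \<in> G)) * (\<Prod>e\<in>G. pmf (bernoulli_pmf p) (e \<in> G))"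
    using \<open>G \<subseteq> E\<close> by (rule prod.subset_diff) simp
  also have "\<dots> = (1 - p) ^ card (E - G) * p ^ card G"
    using p by simp
  also have "card (E - G) = (n choose 2) - card G"
    by (subst card_Diff_subset) (use True in \<open>auto simp: E_def card_edges intro: finite_subset\<close>)
  finally show ?thesis using True by simp
next
  case False
  then have "(\<lambda>f. {e \<in> nsets {..<n} 2. f e}) -` {G} = {}" by auto
  then show ?thesis using False by (simp add: gnp_def pmf_map)
qed

text \<open>
  The binomial weight of \<open>m\<close> carries the factor \<open>N choose m\<close>, which is the number of graphs with
  \<open>m\<close> edges and hence cancels against the uniform distribution on them.
\<close>

lemma gnp_mixture:
  assumes p: "0 \<le> p" "p \<le> 1"
  shows "gnp n p = bind_pmf (binomial_pmf (n choose 2) p) (gnm n)"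
proof (rule pmf_eqI)
  fix G :: "nat set set"
  define N where "N = n choose 2"
  have gnm: "pmf (gnm n m) G = (if G \<in> graphs n m then 1 / real (N choose m) else 0)" if "m \<le> N" for m
    using that graphs_nonempty[of m n] finite_graphs[of n m] card_graphs[of n m]
    by (simp add: gnm_def N_def indicator_def)
  have "pmf (bind_pmf (binomial_pmf N p) (gnm n)) G
      = (\<Sum>m\<le>N. real (N choose m) * p ^ m * (1 - p) ^ (N - m) * pmf (gnm n m) G)"
    using p by (simp add: pmf_bind expectation_binomial_pmf')
  also have "\<dots> = (\<Sum>m\<le>N. if m = card G then
      (if G \<subseteq> nsets {..<n} 2 then p ^ m * (1 - p) ^ (N - m) else 0) else 0)"
    by (rule sum.cong) (auto simp: gnm)
  also have "\<dots> = (if G \<subseteq> nsets {..<n} 2 then p ^ card G * (1 - p) ^ (N - card G) else 0)"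
    using card_mono[of "nsets {..<n} 2" G] by (auto simp: N_def card_edges)
  also have "\<dots> = pmf (gnp n p) G"
    using p by (simp add: pmf_gnp N_def)
  finally show "pmf (gnp n p) G = pmf (bind_pmf (binomial_pmf (n choose 2) p) (gnm n)) G"
    by (simp add: N_def)
qed

lemma oriented_gnp_mixture:
  assumes "0 \<le> p" "p \<le> 1"
  shows "oriented_gnp n p = bind_pmf (binomial_pmf (n choose 2) p) (oriented_gnm n)"
  unfolding oriented_gnp_def oriented_gnm_def gnp_mixture[OF assms] bind_assoc_pmf ..

lemma num_edges_oriented_gnm:
  assumes "m \<le> n choose 2" and "\<omega> \<in> set_pmf (oriented_gnm n m)"
  shows "num_edges \<omega> = m"
  using assms by (auto simp: oriented_gnm_def orient_def num_edges_def set_pmf_gnm)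

section \<open>Invariance under relabelling of the vertices\<close>

text \<open>
  Off the edge set the orientation must keep the dummy value, which \<open>\<pi>\<close> need not fix.
\<close>

definition relabel :: "(nat \<Rightarrow> nat) \<Rightarrow> oriented_graph \<Rightarrow> oriented_graph" where
  "relabel \<pi> \<omega> = ((`) \<pi> ` fst \<omega>,
     \<lambda>e. if e \<in> (`) \<pi> ` fst \<omega> then map_prod \<pi> \<pi> (snd \<omega> (inv \<pi> ` e)) else (0, 0))"

definition orientations :: "nat set set \<Rightarrow> oriented_graph set" where
  "orientations G = {G} \<times> PiE_dflt G (0, 0) (\<lambda>e. {(u, v). e = {u, v}})"

lemma arcs_relabel:
  assumes "bij \<pi>"
  shows "arcs (relabel \<pi> \<omega>) = map_prod \<pi> \<pi> ` arcs \<omega>"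
  using bij_is_inj[OF assms] by (auto simp: arcs_def relabel_def image_image inv_f_f image_inv_f_f)

lemma rtrancl_map_prod:
  assumes "(u, v) \<in> R\<^sup>*"
  shows "(f u, f v) \<in> (map_prod f f ` R)\<^sup>*"
  using assms by induction (auto intro: rtrancl_into_rtrancl)

lemma relabel_in_no_path_iff:
  assumes "bij \<pi>"
  shows "relabel \<pi> \<omega> \<in> no_path (\<pi> u) (\<pi> v) \<longleftrightarrow> \<omega> \<in> no_path u v"
proof -
  have inj: "inj \<pi>" using assms by (rule bij_is_inj)
  have "map_prod (inv \<pi>) (inv \<pi>) ` map_prod \<pi> \<pi> ` R = R" for R
    by (simp add: image_comp map_prod_compose[symmetric] inj prod.map_id0)
  then have "(\<pi> u, \<pi> v) \<in> (map_prod \<pi> \<pi> ` R)\<^sup>* \<longleftrightarrow> (u, v) \<in> R\<^sup>*" for R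
    using rtrancl_map_prod[of u v R \<pi>] rtrancl_map_prod[of "\<pi> u" "\<pi> v" "map_prod \<pi> \<pi> ` R" "inv \<pi>"] inj
    by auto
  then show ?thesis
    by (simp add: no_path_def arcs_relabel assms)
qed

lemma relabel_inv:
  assumes "bij \<pi>" and "\<omega> \<in> orientations G"
  shows "relabel (inv \<pi>) (relabel \<pi> \<omega>) = \<omega>"
proof -
  have inj: "inj \<pi>"
    using assms(1) by (rule bij_is_inj)
  have G: "(`) (inv \<pi>) ` (`) \<pi> ` G = G"
    by (simp add: image_image image_inv_f_f inj)
  have cancel: "inv \<pi> ` \<pi> ` e = e" for e
    by (simp add: image_inv_f_f inj)
  have pair: "map_prod (inv \<pi>) (inv \<pi>) (map_prod \<pi> \<pi> x) = x" for x
    using inj by (cases x) simp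
  show ?thesis
    using assms(2) unfolding relabel_def orientations_def
    by (auto simp: G fun_eq_iff PiE_dflt_def cancel pair inv_inv_eq assms(1))
qed

lemma relabel_orientations:
  assumes "bij \<pi>" and "\<omega> \<in> orientations G"
  shows "relabel \<pi> \<omega> \<in> orientations ((`) \<pi> ` G)"
proof -
  obtain d where \<omega>: "\<omega> = (G, d)" and "d \<in> PiE_dflt G (0, 0) (\<lambda>e. {(u, v). e = {u, v}})"
    using assms(2) by (auto simp: orientations_def)
  then have d: "d e \<in> {(u, v). e = {u, v}}" if "e \<in> G" for e
    using that by (simp add: PiE_dflt_def)
  have "map_prod \<pi> \<pi> (d (inv \<pi> ` e)) \<in> {(u, v). e = {u, v}}" if "e \<in> (`) \<pi> ` G" for e
  proof -
    obtain e' where e': "e' \<in> G" "e = \<pi> ` e'" using \<open>e \<in> (`) \<pi> ` G\<close> by blast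
    then have "inv \<pi> ` e = e'"
      by (simp add: image_inv_f_f bij_is_inj[OF assms(1)])
    then show ?thesis
      using d[OF e'(1)] e'(2) by (cases "d e'") auto
  qed
  then show ?thesis
    by (simp add: \<omega> orientations_def relabel_def PiE_dflt_def)
qed

lemma bij_betw_relabel:
  assumes "bij \<pi>"
  shows "bij_betw (relabel \<pi>) (orientations G) (orientations ((`) \<pi> ` G))"
proof (rule bij_betw_byWitness[where f' = "relabel (inv \<pi>)"])
  have inv: "bij (inv \<pi>)" "inv (inv \<pi>) = \<pi>"
    using assms by (auto simp: bij_imp_bij_inv inv_inv_eq)
  have G: "(`) (inv \<pi>) ` (`) \<pi> ` G = G"
    using bij_is_inj[OF assms] by (simp add: image_image image_inv_f_f)
  show "\<forall>\<omega>\<in>orientations G. relabel (inv \<pi>) (relabel \<pi> \<omega>) = \<omega>"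
    using relabel_inv assms by blast
  show "\<forall>\<omega>\<in>orientations ((`) \<pi> ` G). relabel \<pi> (relabel (inv \<pi>) \<omega>) = \<omega>"
    using relabel_inv[OF inv(1)] inv(2) by simp
  show "relabel \<pi> ` orientations G \<subseteq> orientations ((`) \<pi> ` G)"
    using relabel_orientations assms by blast
  show "relabel (inv \<pi>) ` orientations ((`) \<pi> ` G) \<subseteq> orientations G"
    using relabel_orientations[OF inv(1), of _ "(`) \<pi> ` G"] G by auto
qed

lemma edge_orientations:
  assumes "e \<in> nsets V 2"
  shows "finite {(u, v). e = {u, v}}" and "{(u, v). e = {u, v}} \<noteq> {}"
proof -
  have "finite e" using assms by (simp add: nsets_def)
  moreover have "{(u, v). e = {u, v}} \<subseteq> e \<times> e" by auto
  ultimately show "finite {(u, v). e = {u, v}}"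
    using finite_subset by blast
  show "{(u, v). e = {u, v}} \<noteq> {}"
    using assms by (auto simp: nsets_2_eq)
qed

lemma
  assumes G: "G \<subseteq> nsets {..<n} 2"
  shows finite_orientations: "finite (orientations G)"
    and orientations_nonempty: "orientations G \<noteq> {}"
    and orient_eq_pmf_of_set: "orient G = pmf_of_set (orientations G)"
proof -
  define D where "D = PiE_dflt G (0, 0) (\<lambda>e. {(u, v). e = {u, v :: nat}})"
  have finG: "finite G" using G finite_edges by (rule finite_subset)
  have fin: "finite D" and ne: "D \<noteq> {}"
    unfolding D_def using finG edge_orientations[OF subsetD[OF G]] by auto
  show "finite (orientations G)" "orientations G \<noteq> {}"
    using fin ne by (auto simp: orientations_def D_def[symmetric])
  have "Pi_pmf G (0, 0) (\<lambda>e. pmf_of_set {(u, v). e = {u, v}}) = pmf_of_set D"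
    unfolding D_def using finG G edge_orientations by (intro Pi_pmf_of_set) blast+
  then have "orient G = map_pmf (Pair G) (pmf_of_set D)"
    by (simp add: orient_def)
  also have "\<dots> = pmf_of_set (Pair G ` D)"
    using fin ne by (intro map_pmf_of_set_inj) (auto simp: inj_on_def)
  also have "Pair G ` D = orientations G"
    by (auto simp: orientations_def D_def)
  finally show "orient G = pmf_of_set (orientations G)" .
qed

lemma nsets_image_permutes:
  assumes "\<pi> permutes V"
  shows "(`) \<pi> ` nsets V k = nsets V k"
proof -
  have sub: "(`) \<sigma> ` nsets V k \<subseteq> nsets V k" if "\<sigma> permutes V" for \<sigma>
    using permutes_image[OF that] permutes_inj_on[OF that]
    by (auto simp: nsets_def card_image)
  have "e \<in> (`) \<pi> ` nsets V k" if "e \<in> nsets V k" for e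
  proof
    show "e = \<pi> ` inv \<pi> ` e"
      by (simp add: image_f_inv_f permutes_surj[OF assms])
    show "inv \<pi> ` e \<in> nsets V k"
      using sub[OF permutes_inv[OF assms]] that by blast
  qed
  with sub[OF assms] show ?thesis by blast
qed

lemma bij_betw_graphs:
  assumes "\<pi> permutes {..<n}"
  shows "bij_betw ((`) ((`) \<pi>)) (graphs n m) (graphs n m)"
proof -
  have inj: "inj ((`) ((`) \<pi>))"
    using permutes_inj[OF assms] by (simp add: inj_image_eq_iff inj_on_def)
  have inj': "inj ((`) \<pi>)"
    using permutes_inj[OF assms] by (simp add: inj_image_eq_iff inj_on_def)
  have "(`) ((`) \<pi>) ` graphs n m \<subseteq> graphs n m"
  proof (clarify, intro conjI)
    fix G assume "G \<subseteq> nsets {..<n} 2"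
    then have "(`) \<pi> ` G \<subseteq> (`) \<pi> ` nsets {..<n} 2" by blast
    then show "(`) \<pi> ` G \<subseteq> nsets {..<n} 2"
      by (simp only: nsets_image_permutes[OF assms])
    show "card ((`) \<pi> ` G) = card G"
      by (rule card_image[OF inj_on_subset[OF inj' subset_UNIV]])
  qed
  then have "(`) ((`) \<pi>) ` graphs n m = graphs n m"
    by (rule endo_inj_surj[OF finite_graphs _ inj_on_subset[OF inj subset_UNIV]])
  then show ?thesis
    by (rule bij_betw_imageI[OF inj_on_subset[OF inj subset_UNIV]])
qed

text \<open>
  Both stages of the random choice are uniform: the graph among those with \<open>m\<close> edges, then its
  orientation among all of them.  Relabelling permutes the choices of the first stage and maps the
  choices of the second stage for \<open>G\<close> bijectively to those for the relabelled graph, so it preserves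
  the two-stage distribution.
\<close>

lemma map_relabel_oriented_gnm:
  assumes \<pi>: "\<pi> permutes {..<n}" and m: "m \<le> n choose 2"
  shows "map_pmf (relabel \<pi>) (oriented_gnm n m) = oriented_gnm n m"
proof -
  have "map_pmf (relabel \<pi>) (orient G) = orient ((`) \<pi> ` G)" if "G \<in> set_pmf (gnm n m)" for G
  proof -
    have G: "G \<in> graphs n m" using that m by (simp add: set_pmf_gnm)
    have G': "(`) \<pi> ` G \<in> graphs n m"
      using bij_betwE[OF bij_betw_graphs[OF \<pi>, of m]] G by blast
    from G have "G \<subseteq> nsets {..<n} 2" by simp
    note G = this orient_eq_pmf_of_set[OF this] finite_orientations[OF this]
      orientations_nonempty[OF this]
    from G' have "(`) \<pi> ` G \<subseteq> nsets {..<n} 2" by simp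
    note G' = orient_eq_pmf_of_set[OF this]
    show ?thesis
      unfolding G(2) G' using G(3,4) permutes_bij[OF \<pi>]
      by (intro map_pmf_of_set_bij_betw bij_betw_relabel)
  qed
  then have "map_pmf (relabel \<pi>) (oriented_gnm n m)
      = bind_pmf (gnm n m) (\<lambda>G. orient ((`) \<pi> ` G))"
    unfolding oriented_gnm_def map_bind_pmf by (intro bind_pmf_cong) auto
  also have "\<dots> = bind_pmf (map_pmf ((`) ((`) \<pi>)) (gnm n m)) orient"
    by (simp add: bind_map_pmf)
  also have "map_pmf ((`) ((`) \<pi>)) (gnm n m) = gnm n m"
    unfolding gnm_def
    by (intro map_pmf_of_set_bij_betw bij_betw_graphs \<pi> graphs_nonempty m finite_graphs)
  finally show ?thesis
    by (simp add: oriented_gnm_def)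
qed

lemma prob_no_path_permute:
  assumes \<pi>: "\<pi> permutes {..<n}" and m: "m \<le> n choose 2"
  shows "measure_pmf.prob (oriented_gnm n m) (no_path (\<pi> u) (\<pi> v))
    = measure_pmf.prob (oriented_gnm n m) (no_path u v)"
proof -
  have "measure_pmf.prob (oriented_gnm n m) (no_path (\<pi> u) (\<pi> v))
      = measure_pmf.prob (map_pmf (relabel \<pi>) (oriented_gnm n m)) (no_path (\<pi> u) (\<pi> v))"
    by (simp only: map_relabel_oriented_gnm[OF assms])
  also have "\<dots> = measure_pmf.prob (oriented_gnm n m) (relabel \<pi> -` no_path (\<pi> u) (\<pi> v))"
    by simp
  also have "relabel \<pi> -` no_path (\<pi> u) (\<pi> v) = no_path u v"
    using relabel_in_no_path_iff[OF permutes_bij[OF \<pi>]] by blast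
  finally show ?thesis .
qed

section \<open>The covariance formula\<close>

theorem fact8p1:
  fixes n a s b :: nat and p :: real
  assumes "0 \<le> p" and "p \<le> 1"
    and "a < n" and "s < n" and "b < n"
    and "a \<noteq> s" and "s \<noteq> b" and "a \<noteq> b"
  shows "(map_pmf num_edges (oriented_gnp n p) = binomial_pmf (n choose 2) p)
    \<and> (event_cov (oriented_gnp n p) (no_path a s) (no_path s b)
         = measure_pmf.expectation (oriented_gnp n p)
             (event_cov_given (oriented_gnp n p) (no_path a s) (no_path s b) num_edges)
         + measure_pmf.variance (oriented_gnp n p)
             (prob_given (oriented_gnp n p) (no_path a s) num_edges))
    \<and> (measure_pmf.expectation (oriented_gnp n p)
           (event_cov_given (oriented_gnp n p) (no_path a s) (no_path s b) num_edges)
         = (\<Sum>m = 0..n choose 2.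
              measure_pmf.prob (oriented_gnp n p) {\<omega>. num_edges \<omega> = m}
              * event_cov (oriented_gnm n m) (no_path a s) (no_path s b)))"
proof -
  define Q where "Q = binomial_pmf (n choose 2) p"
  note mixture = oriented_gnp_mixture[OF assms(1,2), of n, folded Q_def]
  have Q: "m \<le> n choose 2" if "m \<in> set_pmf Q" for m
    using that assms(1,2) by (auto simp: Q_def set_pmf_binomial_eq split: if_splits)
  have index: "num_edges \<omega> = m" if "m \<in> set_pmf Q" "\<omega> \<in> set_pmf (oriented_gnm n m)" for m \<omega>
    using num_edges_oriented_gnm that Q by blast
  \<comment> \<open>The three-cycle \<open>a \<mapsto> s \<mapsto> b \<mapsto> a\<close>.\<close>
  define \<pi> where "\<pi> = Transposition.transpose a b \<circ> Transposition.transpose a s"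
  have \<pi>: "\<pi> permutes {..<n}" "\<pi> a = s" "\<pi> s = b"
    unfolding \<pi>_def using assms(3-8)
    by (auto intro!: permutes_compose permutes_swap_id simp: Transposition.transpose_def)
  have same: "measure_pmf.prob (oriented_gnm n m) (no_path a s)
      = measure_pmf.prob (oriented_gnm n m) (no_path s b)" if "m \<in> set_pmf Q" for m
    using prob_no_path_permute[OF \<pi>(1) Q[OF that], of a s] \<pi>(2,3) by simp
  have edges: "map_pmf num_edges (oriented_gnp n p) = Q"
    unfolding mixture by (rule map_pmf_mixture) (rule index)
  have prob_edges: "measure_pmf.prob (oriented_gnp n p) {\<omega>. num_edges \<omega> = m} = pmf Q m" for m
    unfolding edges[symmetric] by (simp add: pmf_map vimage_def)
  have "measure_pmf.expectation (oriented_gnp n p)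
      (event_cov_given (oriented_gnp n p) (no_path a s) (no_path s b) num_edges)
      = measure_pmf.expectation Q (\<lambda>m. event_cov (oriented_gnm n m) (no_path a s) (no_path s b))"
    unfolding mixture by (rule expectation_event_cov_given_mixture) (rule index)
  also have "\<dots> = (\<Sum>m = 0..n choose 2. pmf Q m *\<^sub>R
      event_cov (oriented_gnm n m) (no_path a s) (no_path s b))"
    using Q by (intro integral_measure_pmf) auto
  finally have sum: "measure_pmf.expectation (oriented_gnp n p)
      (event_cov_given (oriented_gnp n p) (no_path a s) (no_path s b) num_edges)
      = (\<Sum>m = 0..n choose 2. measure_pmf.prob (oriented_gnp n p) {\<omega>. num_edges \<omega> = m}
          * event_cov (oriented_gnm n m) (no_path a s) (no_path s b))"
    by (simp add: prob_edges)
  have "event_cov (oriented_gnp n p) (no_path a s) (no_path s b)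
      = measure_pmf.expectation (oriented_gnp n p)
          (event_cov_given (oriented_gnp n p) (no_path a s) (no_path s b) num_edges)
      + measure_pmf.variance (oriented_gnp n p)
          (prob_given (oriented_gnp n p) (no_path a s) num_edges)"
    unfolding mixture by (rule event_cov_mixture) (auto simp: index same)
  with edges sum show ?thesis
    by (simp add: Q_def)
qed

end
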